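(* For fixed integers $d,n\ge1$ there is only one projection regular lattice point set in $[0,1)^d$ that consists of $n$ points and has the NNLD property, namely the lattice point set $$\Bigl\{\boldsymbol{0},\tfrac1n\boldsymbol{1},\tfrac2n\boldsymbol{1},\dots,\tfrac{n-1}{n}\boldsymbol{1}\Bigr\},$$ whose points all lie on the main diagonal of the $d$-dimensional unit cube $[0,1)^d$.
   Context: $\boldsymbol{0}$ and $\boldsymbol{1}$ are the all-zeros and all-ones vectors in $\mathbb{R}^d$. A lattice point set in $[0,1)^d$ is the point set of an integration lattice (of arbitrary rank): $P=L\cap[0,1)^d$, where $L\subset\mathbb{R}^d$ is a discrete additive subgroup containing $\mathbb{Z}^d$. Equivalently, $P$ is a finite subset of $[0,1)^d$ forming a group under componentwise addition modulo 1. A point set $P_n$ of $n$ points in $[0,1)^d$ is projection regular if its projection onto each single coordinate equals the full set $\{0,1/n,2/n,\dots,(n-1)/n\}$. A point set $P_n$ with points $\boldsymbol{x}_0,\dots,\boldsymbol{x}_{n-1}\in[0,1]^d$ has the NNLD (non-negative local discrepancy) property if for every $\boldsymbol{z}\in[0,1]^d$, $$\frac1n\#\{0\le i<n: 0\le x_{ij}<z_j\text{ for all }j=1,\dots,d\}\ \ge\ \prod_{j=1}^d z_j.$$ *)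

theory Defs
  imports "HOL-Analysis.Analysis"
begin

definition unit_cube :: "(real ^ 'd) set" where
  "unit_cube = {x. \<forall>j. 0 \<le> x $ j \<and> x $ j < 1}"

text \<open>
  Integration lattices are of arbitrary rank as lattice rules, but always contain the
  integer lattice.
\<close>

definition integration_lattice :: "(real ^ 'd) set \<Rightarrow> bool" where
  "integration_lattice L \<longleftrightarrow>
     0 \<in> L \<and> (\<forall>x\<in>L. \<forall>y\<in>L. x + y \<in> L) \<and> (\<forall>x\<in>L. - x \<in> L) \<and>
     discrete L \<and> {x. \<forall>j. x $ j \<in> \<int>} \<subseteq> L"

definition lattice_point_set :: "(real ^ 'd) set \<Rightarrow> bool" where
  "lattice_point_set P \<longleftrightarrow> (\<exists>L. integration_lattice L \<and> P = L \<inter> unit_cube)"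

definition projection_regular :: "(real ^ 'd) set \<Rightarrow> bool" where
  "projection_regular P \<longleftrightarrow>
     finite P \<and> P \<subseteq> unit_cube \<and>
     (\<forall>j. (\<lambda>x. x $ j) ` P = {real i / real (card P) | i. i < card P})"

text \<open>
  Non-negative local discrepancy. The anchored test boxes are half-open, while the
  corner \<open>z\<close> ranges over the closed cube.
\<close>

definition NNLD :: "(real ^ 'd) set \<Rightarrow> bool" where
  "NNLD P \<longleftrightarrow>
     finite P \<and> P \<subseteq> cbox 0 1 \<and>
     (\<forall>z\<in>cbox 0 1.
        real (card {x \<in> P. \<forall>j. 0 \<le> x $ j \<and> x $ j < z $ j}) / real (card P) \<ge> (\<Prod>j\<in>UNIV. z $ j))"

text \<open>Here \<open>1\<close> is the all-ones vector.\<close>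

definition diagonal_point_set :: "nat \<Rightarrow> (real ^ 'd) set" where
  "diagonal_point_set n = {(real i / real n) *\<^sub>R 1 | i. i < n}"

end

theory Submission
  imports Defs
begin

text \<open>
  By projection regularity, each coordinate projection is injective on a lattice point set \<open>P\<close>, so
  \<open>P\<close> is the cyclic group (modulo 1) generated by the point \<open>h\<close> with \<open>h\<^sub>j = 1/n\<close>, for any fixed \<open>j\<close>.
  Let \<open>h\<^sub>l = g/n\<close>, and let \<open>k\<close> be maximal with \<open>k g < n\<close>. The anchored box with sides \<open>(k+1)/n\<close> and
  \<open>k g/n\<close> in directions \<open>j\<close> and \<open>l\<close> contains at most the points \<open>i h\<close> with \<open>i < k\<close>, so NNLD gives
  \<open>(k+1) g \<le> n\<close> and hence \<open>(k+1) g = n\<close>. Then \<open>(k+1) h\<close> vanishes in coordinate \<open>l\<close> modulo 1, so it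
  vanishes altogether, which forces \<open>k + 1 = n\<close> and \<open>g = 1\<close>.
\<close>

section \<open>Multiples of a point modulo 1\<close>

lemma integration_lattice_scaleR:
  fixes L :: "(real ^ 'd) set"
  assumes "integration_lattice L" "x \<in> L"
  shows "real i *\<^sub>R x \<in> L"
proof (induction i)
  case 0
  show ?case using assms by (simp add: integration_lattice_def)
next
  case (Suc i)
  hence "x + real i *\<^sub>R x \<in> L"
    using assms unfolding integration_lattice_def by blast
  thus ?case by (simp add: algebra_simps)
qed

text \<open>The \<open>i\<close>-fold sum of \<open>x\<close> in the group (R/Z)^d, taken by its
  representative in the half-open cube.\<close>

definition frac_multiple :: "nat \<Rightarrow> real ^ 'd \<Rightarrow> real ^ 'd" where
  "frac_multiple i x = (\<chi> m. frac (real i * x $ m))"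

lemma frac_multiple_in_lattice_point_set:
  fixes P :: "(real ^ 'd) set"
  assumes "lattice_point_set P" "x \<in> P"
  shows "frac_multiple i x \<in> P"
proof -
  obtain L where L: "integration_lattice L" and P: "P = L \<inter> unit_cube"
    using assms(1) by (auto simp: lattice_point_set_def)
  \<comment> \<open>An integer vector, hence in \<open>L\<close>, that moves the multiple back into
    the unit cube.\<close>
  define v :: "real ^ 'd" where "v = (\<chi> m. - of_int \<lfloor>real i * x $ m\<rfloor>)"
  have "v \<in> L"
    using L by (auto simp: integration_lattice_def v_def)
  moreover have "real i *\<^sub>R x \<in> L"
    using integration_lattice_scaleR[OF L] assms(2) P by auto
  ultimately have "real i *\<^sub>R x + v \<in> L"
    using L by (auto simp: integration_lattice_def)
  also have "real i *\<^sub>R x + v = frac_multiple i x"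
    by (simp add: vec_eq_iff v_def frac_multiple_def frac_def)
  finally show ?thesis
    by (auto simp: P unit_cube_def frac_multiple_def frac_ge_0 frac_lt_1)
qed

lemma zero_in_lattice_point_set: "lattice_point_set P \<Longrightarrow> 0 \<in> P"
  by (auto simp: lattice_point_set_def integration_lattice_def unit_cube_def)

section \<open>Coordinate projections and two-dimensional boxes\<close>

lemma frac_of_nat_divide:
  "i < n \<Longrightarrow> frac (real i / real n) = real i / real n"
  by (simp add: frac_eq)

lemma card_fractions: "n \<ge> 1 \<Longrightarrow> card {real i / real n | i. i < n} = n"
proof -
  assume "n \<ge> 1"
  have "{real i / real n | i. i < n} = (\<lambda>i. real i / real n) ` {..<n}" by auto
  also have "card \<dots> = n"
    using \<open>n \<ge> 1\<close> by (subst card_image) (auto simp: inj_on_def)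
  finally show ?thesis .
qed

text \<open>The image has as many elements as the finite set \<open>P\<close>. Hence a single
  coordinate identifies a point of \<open>P\<close>.\<close>

lemma projection_regular_inj_on:
  assumes "projection_regular P" "card P \<ge> 1"
  shows "inj_on (\<lambda>x. x $ j) P"
  using assms by (intro eq_card_imp_inj_on) (auto simp: projection_regular_def card_fractions)

lemma projection_regular_obtain:
  assumes "projection_regular P" "x \<in> P"
  obtains i where "i < card P" "x $ j = real i / real (card P)"
  using assms unfolding projection_regular_def by blast

text \<open>Give the test box side 1 in all other directions: the volume stays \<open>a * b\<close>,
  and points of the half-open cube satisfy those constraints automatically.\<close>

lemma NNLD_two_coordinates:
  fixes P :: "(real ^ 'd) set"
  assumes "NNLD P" "P \<subseteq> unit_cube" "j \<noteq> l" "0 \<le> a" "a \<le> 1" "0 \<le> b" "b \<le> 1"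
  shows "real (card {x \<in> P. x $ j < a \<and> x $ l < b}) / real (card P) \<ge> a * b"
proof -
  define z :: "real ^ 'd" where "z = (\<chi> m. if m = j then a else if m = l then b else 1)"
  have "z \<in> cbox 0 1"
    using assms by (auto simp: z_def mem_box_cart)
  hence "(\<Prod>m\<in>UNIV. z $ m)
      \<le> real (card {x \<in> P. \<forall>m. 0 \<le> x $ m \<and> x $ m < z $ m}) / real (card P)"
    using assms(1) by (simp add: NNLD_def)
  moreover have "(\<Prod>m\<in>UNIV. z $ m) = a * b"
  proof -
    have "(\<Prod>m\<in>UNIV. z $ m) = (\<Prod>m\<in>{j, l}. z $ m)"
      by (intro prod.mono_neutral_right) (auto simp: z_def)
    thus ?thesis using \<open>j \<noteq> l\<close> by (simp add: z_def)
  qed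
  moreover have "{x \<in> P. \<forall>m. 0 \<le> x $ m \<and> x $ m < z $ m} = {x \<in> P. x $ j < a \<and> x $ l < b}"
  proof -
    have "(\<forall>m. 0 \<le> x $ m \<and> x $ m < z $ m) \<longleftrightarrow> x $ j < a \<and> x $ l < b" if "x \<in> P" for x
    proof -
      have "\<forall>m. 0 \<le> x $ m \<and> x $ m < 1"
        using that assms(2) by (auto simp: unit_cube_def)
      thus ?thesis using \<open>j \<noteq> l\<close> by (auto simp: z_def)
    qed
    thus ?thesis by blast
  qed
  ultimately show ?thesis by simp
qed

section \<open>Uniqueness\<close>

lemma NNLD_generator_on_diagonal:
  fixes P :: "(real ^ 'd) set"
  assumes lat: "lattice_point_set P" and reg: "projection_regular P" and nnld: "NNLD P"
    and n: "card P = n" "n \<ge> 2" and h: "h \<in> P" "h $ j = 1 / real n"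
  shows "h $ l = 1 / real n"
proof (cases "j = l")
  case False
  have inj: "inj_on (\<lambda>x. x $ m) P" for m
    using projection_regular_inj_on[OF reg] n by simp
  have zero: "0 \<in> P"
    using lat by (rule zero_in_lattice_point_set)
  have eqI: "x = y" if "x \<in> P" "y \<in> P" "x $ m = y $ m" for x y m
    using inj that by (auto dest: inj_onD)
  obtain g where g: "g < n" "h $ l = real g / real n"
    using projection_regular_obtain[OF reg h(1)] n by metis
  \<comment> \<open>If \<open>g = 0\<close>, then \<open>h\<close> agrees with 0 in coordinate
    \<open>l\<close>, so \<open>h = 0\<close>, against \<open>h $ j = 1 / real n\<close>.\<close>
  have "g > 0"
    using eqI[OF h(1) zero, of l] g h(2) n by (cases "g = 0") auto
  \<comment> \<open>Dividing \<open>n - 1\<close> instead of \<open>n\<close> keeps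
    \<open>k * g < n\<close> strict even when \<open>g\<close> divides \<open>n\<close>.\<close>
  define k where "k = (n - 1) div g"
  have kg: "k * g < n" "n \<le> (k + 1) * g"
  proof -
    have "k * g \<le> n - 1" by (simp add: k_def)
    thus "k * g < n" using n by simp
    have "n - 1 < (k + 1) * g"
      using dividend_less_div_times[OF \<open>g > 0\<close>, of "n - 1"] by (simp add: k_def)
    thus "n \<le> (k + 1) * g" by simp
  qed
  have "k > 0"
    using g \<open>g > 0\<close> by (simp add: k_def div_greater_zero_iff)
  have "k < n"
    using kg(1) \<open>g > 0\<close> by (metis le_less_trans mult_le_mono2 nat_mult_1_right Suc_leI One_nat_def)
  have y: "frac_multiple i h \<in> P" for i
    using frac_multiple_in_lattice_point_set[OF lat h(1)] .
  have yj: "frac_multiple i h $ j = frac (real i / real n)" for i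
    by (simp add: frac_multiple_def h)
  have yl: "frac_multiple i h $ l = frac (real (i * g) / real n)" for i
    by (simp add: frac_multiple_def g)
  \<comment> \<open>The strict bound in direction \<open>j\<close> admits the multiples with index
    at most \<open>k\<close>; the one in direction \<open>l\<close> then excludes index
    \<open>k\<close> itself.\<close>
  define B where "B = {x \<in> P. x $ j < real (k + 1) / real n \<and> x $ l < real (k * g) / real n}"
  have "(\<lambda>x. x $ j) ` B \<subseteq> (\<lambda>i. real i / real n) ` {..<k}"
  proof clarify
    fix x assume "x \<in> B"
    hence x: "x \<in> P" "x $ j < real (k + 1) / real n" "x $ l < real (k * g) / real n"
      by (auto simp: B_def)
    obtain i where i: "i < n" "x $ j = real i / real n"
      using projection_regular_obtain[OF reg x(1)] n by metis
    have "i \<le> k"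
      using x(2) i n by (simp add: divide_less_cancel)
    have "x = frac_multiple i h"
      using i by (intro eqI[of _ _ j] x y) (simp add: yj frac_of_nat_divide)
    \<comment> \<open>No wrap-around modulo 1 occurs, so the \<open>l\<close>-coordinate is exactly
      \<open>i * g / n\<close>.\<close>
    moreover have "i * g < n"
      using \<open>i \<le> k\<close> kg(1) by (meson le_less_trans mult_le_mono1)
    ultimately have "x $ l = real (i * g) / real n"
      by (simp only: yl frac_of_nat_divide)
    hence "i * g < k * g"
      using x(3) n by (simp add: divide_less_cancel flip: of_nat_mult)
    thus "x $ j \<in> (\<lambda>i. real i / real n) ` {..<k}"
      using i by auto
  qed
  hence "card ((\<lambda>x. x $ j) ` B) \<le> card ((\<lambda>i. real i / real n) ` {..<k})"
    by (intro card_mono) auto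
  also have "\<dots> \<le> k"
    using card_image_le[of "{..<k}"] by simp
  also have "card ((\<lambda>x. x $ j) ` B) = card B"
    using inj by (intro card_image) (auto simp: inj_on_def B_def)
  finally have "card B \<le> k" .
  \<comment> \<open>Both sides of the box are at most 1 because \<open>k < n\<close> and
    \<open>k * g < n\<close>. Comparing its volume with the count \<open>k\<close> and cancelling
    \<open>k\<close> leaves \<open>(k + 1) * g \<le> n\<close>.\<close>
  have "real (k + 1) / real n * (real (k * g) / real n) \<le> real (card B) / real n"
    using NNLD_two_coordinates[OF nnld _ False, of "real (k + 1) / real n" "real (k * g) / real n"]
      reg kg(1) \<open>k < n\<close> n
    by (simp add: B_def projection_regular_def flip: of_nat_mult)
  also have "\<dots> \<le> real k / real n"
    using \<open>card B \<le> k\<close> by (simp add: divide_right_mono)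
  finally have "real (k + 1) * real (k * g) / real n / real n \<le> real k / real n"
    by (simp only: times_divide_eq_left times_divide_eq_right)
  hence "real (k + 1) * real (k * g) / real n \<le> real k"
    using n by (subst (asm) divide_le_cancel) simp
  hence "real ((k + 1) * (k * g)) \<le> real (k * n)"
    using n by (simp only: of_nat_mult pos_divide_le_eq)
  hence "k * ((k + 1) * g) \<le> k * n"
    unfolding of_nat_le_iff by (simp add: algebra_simps)
  hence "(k + 1) * g = n"
    using \<open>k > 0\<close> kg(2) by simp
  hence "frac_multiple (k + 1) h $ l = 0 $ l"
    using n by (simp only: yl) simp
  hence "frac_multiple (k + 1) h = 0"
    by (rule eqI[OF y zero])
  hence "frac (real (k + 1) / real n) = 0"
    using yj[of "k + 1"] by simp
  \<comment> \<open>If \<open>k + 1 < n\<close>, the fractional part would be the positive number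
    \<open>(k + 1) / n\<close>.\<close>
  hence "k + 1 = n"
    using frac_of_nat_divide[of "k + 1" n] \<open>k < n\<close> by (cases "k + 1 < n") auto
  hence "g = 1"
    using \<open>(k + 1) * g = n\<close> n by simp
  thus ?thesis using g by simp
qed (use h in simp)

lemma diagonal_point_set_eq_image:
  "diagonal_point_set n = (\<lambda>i. (real i / real n) *\<^sub>R 1) ` {..<n}"
  by (auto simp: diagonal_point_set_def)

lemma card_diagonal_point_set:
  assumes "n \<ge> 1"
  shows "card (diagonal_point_set n :: (real ^ 'd) set) = n"
  unfolding diagonal_point_set_eq_image using assms
  by (subst card_image) (auto simp: inj_on_def vec_eq_iff)

text \<open>The point of \<open>P\<close> with one coordinate \<open>1 / n\<close> has all
  coordinates \<open>1 / n\<close>, so its multiples are the diagonal points; counting turns the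
  inclusion into equality.\<close>

lemma NNLD_lattice_point_set_eq_diagonal:
  fixes P :: "(real ^ 'd) set"
  assumes lat: "lattice_point_set P" and reg: "projection_regular P" and nnld: "NNLD P"
    and n: "card P = n" "n \<ge> 1"
  shows "P = diagonal_point_set n"
proof -
  have "diagonal_point_set n \<subseteq> P"
  \<comment> \<open>For \<open>n = 1\<close> the value \<open>1 / n = 1\<close> is not a coordinate
    of any point of \<open>P\<close>, but the diagonal set is just the origin.\<close>
  proof (cases "n = 1")
    case True
    thus ?thesis
      using zero_in_lattice_point_set[OF lat] by (auto simp: diagonal_point_set_def)
  next
    case False
    fix j :: 'd
    have "1 / real n \<in> (\<lambda>x. x $ j) ` P"
      using reg n False unfolding projection_regular_def by (auto intro!: exI[of _ 1])
    then obtain h where h: "h \<in> P" "h $ j = 1 / real n" by auto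
    have "h $ l = 1 / real n" for l
      using NNLD_generator_on_diagonal[OF lat reg nnld n(1) _ h] n False by simp
    hence "(real i / real n) *\<^sub>R 1 = frac_multiple i h" if "i < n" for i
      using that by (simp add: vec_eq_iff frac_multiple_def frac_of_nat_divide)
    thus ?thesis
      using frac_multiple_in_lattice_point_set[OF lat h(1)]
      by (auto simp: diagonal_point_set_def)
  qed
  moreover have "finite P" using reg by (simp add: projection_regular_def)
  ultimately show ?thesis
    using n card_diagonal_point_set[OF n(2)] by (metis card_subset_eq)
qed

section \<open>The diagonal point set has the three properties\<close>

lemma lattice_point_set_diagonal:
  assumes "n \<ge> 1"
  shows "lattice_point_set (diagonal_point_set n :: (real ^ 'd) set)"
proof -
  \<comment> \<open>This is Z^d + Z (1/n, ..., 1/n): one integer \<open>i\<close> serves all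
    coordinates.\<close>
  define L :: "(real ^ 'd) set" where
    "L = {x. \<exists>i :: int. \<forall>j. x $ j - of_int i / real n \<in> \<int>}"
  have "discrete L"
  proof -
    \<comment> \<open>Scaling \<open>L\<close> by \<open>n\<close> gives integer vectors, so
      distinct points differ by at least \<open>1 / n\<close> in some coordinate.\<close>
    have "dist x y \<ge> 1 / real n" if xy: "x \<in> L" "y \<in> L" "x \<noteq> y" for x y
    proof -
      have int: "real n * x $ j \<in> \<int>" if "x \<in> L" for x j
      proof -
        obtain i :: int where "x $ j - of_int i / real n \<in> \<int>"
          using \<open>x \<in> L\<close> by (auto simp: L_def)
        hence "real n * (x $ j - of_int i / real n) + of_int i \<in> \<int>" by simp
        thus ?thesis using assms by (simp add: field_simps)
      qed
      obtain j where "x $ j \<noteq> y $ j" using xy(3) by (auto simp: vec_eq_iff)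
      hence "real n * x $ j - real n * y $ j \<noteq> 0" using assms by simp
      moreover have "real n * x $ j - real n * y $ j \<in> \<int>" using int xy by simp
      ultimately have "\<bar>real n * x $ j - real n * y $ j\<bar> \<ge> 1"
        by (rule Ints_nonzero_abs_ge1[rotated])
      hence "real n * \<bar>x $ j - y $ j\<bar> \<ge> 1"
        by (simp only: abs_mult abs_of_nat flip: right_diff_distrib)
      hence "\<bar>x $ j - y $ j\<bar> \<ge> 1 / real n"
        using assms by (simp add: pos_divide_le_eq mult.commute)
      also have "\<bar>x $ j - y $ j\<bar> \<le> dist x y"
        using dist_vec_nth_le[of x j y] by (simp add: dist_real_def)
      finally show ?thesis .
    qed
    hence "\<exists>e>0. \<forall>y\<in>L. dist x y < e \<longrightarrow> y = x" if "x \<in> L" for x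
      using that assms by (intro exI[of _ "1 / real n"]) force
    thus ?thesis
      by (auto simp: discrete_def isolated_in_dist_Ex_iff)
  qed
  moreover have "0 \<in> L" by (auto simp: L_def intro!: exI[of _ 0])
  moreover have "x + y \<in> L" if xy: "x \<in> L" "y \<in> L" for x y
  proof -
    obtain a b :: int where "\<forall>j. x $ j - of_int a / real n \<in> \<int>" "\<forall>j. y $ j - of_int b / real n \<in> \<int>"
      using xy by (auto simp: L_def)
    hence "\<forall>j. (x $ j - of_int a / real n) + (y $ j - of_int b / real n) \<in> \<int>" by simp
    thus ?thesis
      by (auto simp: L_def add_divide_distrib algebra_simps intro!: exI[of _ "a + b"])
  qed
  moreover have "- x \<in> L" if x: "x \<in> L" for x
  proof -
    obtain a :: int where "\<forall>j. x $ j - of_int a / real n \<in> \<int>" using x by (auto simp: L_def)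
    hence "\<forall>j. - (x $ j - of_int a / real n) \<in> \<int>" by (auto simp del: minus_diff_eq)
    thus ?thesis by (auto simp: L_def intro!: exI[of _ "-a"])
  qed
  moreover have "{x. \<forall>j. x $ j \<in> \<int>} \<subseteq> L" by (auto simp: L_def intro!: exI[of _ 0])
  ultimately have "integration_lattice L" by (simp add: integration_lattice_def)
  moreover have "diagonal_point_set n = L \<inter> unit_cube"
  proof (intro equalityI subsetI)
    fix x :: "real ^ 'd" assume "x \<in> diagonal_point_set n"
    then obtain i where i: "i < n" "x = (real i / real n) *\<^sub>R 1"
      by (auto simp: diagonal_point_set_def)
    thus "x \<in> L \<inter> unit_cube"
      by (auto simp: L_def unit_cube_def intro!: exI[of _ "int i"])
  next
    fix x :: "real ^ 'd" assume x: "x \<in> L \<inter> unit_cube"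
    then obtain a :: int where a: "\<forall>j. x $ j - of_int a / real n \<in> \<int>" by (auto simp: L_def)
    \<comment> \<open>Reducing \<open>a\<close> modulo \<open>n\<close> changes \<open>a / n\<close>
      by an integer and yields an admissible diagonal index.\<close>
    define r where "r = nat (a mod int n)"
    have "r < n"
      using assms by (simp add: r_def nat_less_iff)
    have "a = (a div int n) * int n + int r"
      using assms by (simp add: r_def)
    hence "real_of_int a = real_of_int (a div int n) * real n + real r"
      by (metis of_int_add of_int_mult of_int_of_nat_eq)
    hence "real_of_int a / real n = real_of_int (a div int n) + real r / real n"
      using assms by (simp add: add_divide_distrib)
    hence "x $ j - real r / real n = (x $ j - of_int a / real n) + of_int (a div int n)" for j
      by simp
    hence "x $ j - real r / real n \<in> \<int>" for j
      using a by (metis Ints_add Ints_of_int)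
    hence "frac (x $ j) = real r / real n" for j
      using \<open>r < n\<close> by (simp add: frac_unique_iff)
    moreover have "frac (x $ j) = x $ j" for j
      using x by (simp add: unit_cube_def frac_eq)
    ultimately have "x = (real r / real n) *\<^sub>R 1"
      by (simp add: vec_eq_iff)
    thus "x \<in> diagonal_point_set n"
      using \<open>r < n\<close> by (auto simp: diagonal_point_set_def)
  qed
  ultimately show ?thesis unfolding lattice_point_set_def by blast
qed

lemma projection_regular_diagonal:
  assumes "n \<ge> 1"
  shows "projection_regular (diagonal_point_set n :: (real ^ 'd) set)"
  unfolding projection_regular_def card_diagonal_point_set[OF assms]
  by (auto simp: unit_cube_def diagonal_point_set_eq_image image_image)

text \<open>A diagonal point lies in the box as soon as its common coordinate is below the smallest
  side, and the volume is at most that side since the other sides are at most 1.\<close>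

lemma NNLD_diagonal:
  assumes "n \<ge> 1"
  shows "NNLD (diagonal_point_set n :: (real ^ 'd) set)"
  unfolding NNLD_def card_diagonal_point_set[OF assms]
proof (intro conjI ballI)
  show "finite (diagonal_point_set n :: (real ^ 'd) set)"
    by (simp add: diagonal_point_set_eq_image)
  show "diagonal_point_set n \<subseteq> (cbox 0 1 :: (real ^ 'd) set)"
    by (auto simp: diagonal_point_set_def mem_box_cart)
  fix z :: "real ^ 'd" assume z: "z \<in> cbox 0 1"
  hence z01: "0 \<le> z $ j" "z $ j \<le> 1" for j by (auto simp: mem_box_cart)
  have "Min (range (\<lambda>j. z $ j)) \<in> range (\<lambda>j. z $ j)" by (intro Min_in) auto
  then obtain j where j: "z $ j = Min (range (\<lambda>j. z $ j))" by (metis imageE)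
  have min: "z $ j \<le> z $ l" for l unfolding j by (intro Min_le) auto
  \<comment> \<open>The ceiling matches the half-open box: \<open>i < m\<close> means exactly
    \<open>i / n < z $ j\<close>, and \<open>m / n\<close> is still at least
    \<open>z $ j\<close>.\<close>
  define m where "m = nat \<lceil>real n * z $ j\<rceil>"
  have "real n * z $ j \<le> real n" using z01[of j] by (simp add: mult_left_le)
  hence "m \<le> n" unfolding m_def by (simp add: nat_le_iff ceiling_le_iff)
  have lt: "real i / real n < z $ l" if "i < m" for i l
  proof -
    have "int i < \<lceil>real n * z $ j\<rceil>" using that by (simp add: m_def zless_nat_eq_int_zless)
    hence "real i < real n * z $ j" by (simp add: less_ceiling_iff)
    hence "real i / real n < z $ j" using assms by (simp add: field_simps)
    also have "\<dots> \<le> z $ l" by (rule min)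
    finally show ?thesis .
  qed
  have "(\<Prod>l\<in>UNIV. z $ l) = z $ j * (\<Prod>l\<in>UNIV - {j}. z $ l)"
    by (simp add: prod.remove)
  also have "\<dots> \<le> z $ j"
    using z01 by (intro mult_left_le prod_le_1) auto
  also have "\<dots> \<le> real m / real n"
    using assms real_nat_ceiling_ge[of "real n * z $ j"] by (simp add: m_def field_simps)
  also have "m = card ((\<lambda>i. (real i / real n) *\<^sub>R (1 :: real ^ 'd)) ` {..<m})"
    using assms by (subst card_image) (auto simp: inj_on_def vec_eq_iff)
  also have "\<dots> \<le> card {x \<in> diagonal_point_set n. \<forall>j. 0 \<le> x $ j \<and> x $ j < z $ j}"
    using \<open>m \<le> n\<close> lt
    by (intro card_mono) (auto simp: diagonal_point_set_eq_image)
  finally show "(\<Prod>l\<in>UNIV. z $ l)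
      \<le> real (card {x \<in> diagonal_point_set n. \<forall>j. 0 \<le> x $ j \<and> x $ j < z $ j}) / real n"
    by (simp add: divide_right_mono)
qed

theorem corollary1:
  fixes n :: nat
  assumes "n \<ge> 1"
  shows "{P :: (real ^ 'd) set.
            lattice_point_set P \<and> card P = n \<and> projection_regular P \<and> NNLD P}
           = {diagonal_point_set n}
         \<and> (diagonal_point_set n :: (real ^ 'd) set) \<subseteq> {t *\<^sub>R 1 | t. 0 \<le> t \<and> t < 1}"
proof
  show "{P :: (real ^ 'd) set.
            lattice_point_set P \<and> card P = n \<and> projection_regular P \<and> NNLD P}
           = {diagonal_point_set n}"
    using NNLD_lattice_point_set_eq_diagonal[of _ n] lattice_point_set_diagonal[OF assms]
      card_diagonal_point_set[OF assms] projection_regular_diagonal[OF assms] NNLD_diagonal[OF assms]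
      assms by blast
  show "(diagonal_point_set n :: (real ^ 'd) set) \<subseteq> {t *\<^sub>R 1 | t. 0 \<le> t \<and> t < 1}"
    by (force simp: diagonal_point_set_def)
qed

end
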